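(* Let $G\subset\mathbb{R}^n$ be a neighborhood of the origin and let $\frac{d\mathbf{x}}{dt}=\mathbf{f}(\mathbf{x})$ be an autonomous system of ordinary differential equations given in $G$, for which the origin $\mathbf{0}$ is an isolated equilibrium. Suppose that in $G$ there is a convergent sequence of hypersurfaces $\mathbf{H}_i^{n-1}$ ($i=1,2,\dots$), with associated compact sets $\mathbf{K}_i$, and for each $i$ let $\vec N$ be the unit normal vector field on $\mathbf{H}_i^{n-1}$ directed to the inside of $\mathbf{K}_i$. If for every $i$ and every $\mathbf{x}\in\mathbf{H}_i^{n-1}$ one has $S(\mathbf{x})=\langle \vec N(\mathbf{x}),\mathbf{f}(\mathbf{x})\rangle>0$, then the equilibrium $\mathbf{0}$ of the system is stable in the sense of Lyapunov.
   Context: A compact connected smooth $(n-1)$-dimensional submanifold $\mathbf{H}^{n-1}$ of $\mathbb{R}^n$ lying in $G$ is said to restrict the origin if $\mathbf{0}\notin\mathbf{H}^{n-1}$ and $\mathbf{H}^{n-1}$ is the boundary of a compact set $\mathbf{K}$ containing the origin. A sequence $\mathbf{H}_i^{n-1}$ ($i=1,2,\dots$) of hypersurfaces restricting the origin is a convergent sequence of hypersurfaces if the $\mathbf{H}_i^{n-1}$ are pairwise disjoint and there are compact sets $\mathbf{K}_i$ containing the origin with boundary $\mathbf{H}_i^{n-1}$ such that $\bigcap_i\mathbf{K}_i=\{\mathbf{0}\}$ and $\mathbf{K}_i\supset\mathbf{K}_j$ for $i<j$. Here $\langle\cdot,\cdot\rangle$ is the Euclidean inner product. The map $\mathbf{f}:G\to\mathbb{R}^n$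 is continuous and through every point of $G$ there passes a unique phase curve (solution) of the system. An equilibrium is a zero of $\mathbf{f}$; it is isolated if it has a neighborhood containing no other zero of $\mathbf{f}$. *)

theory Defs
  imports "HOL-Analysis.Analysis"
begin

section \<open>Smooth submanifolds of Euclidean space\<close>

text \<open>
  \<open>Ck_on k f S\<close> is meant for open \<open>S\<close>. Continuity of all directional derivatives
  \<open>x \<mapsto> Df(x) v\<close> is continuity of \<open>Df\<close> because the domain will be finite-dimensional.
\<close>

primrec Ck_on :: "nat \<Rightarrow> ('a::real_normed_vector \<Rightarrow> 'b::real_normed_vector) \<Rightarrow> 'a set \<Rightarrow> bool" where
  "Ck_on 0 f S \<longleftrightarrow> continuous_on S f"
| "Ck_on (Suc k) f S \<longleftrightarrow>
     (\<forall>x\<in>S. f differentiable (at x)) \<and> (\<forall>v. Ck_on k (\<lambda>x. frechet_derivative f (at x) v) S)"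

definition smooth_on :: "'a::real_normed_vector set \<Rightarrow> ('a \<Rightarrow> 'b::real_normed_vector) \<Rightarrow> bool" where
  "smooth_on S f \<longleftrightarrow> (\<forall>k. Ck_on k f S)"

definition smooth_submanifold :: "nat \<Rightarrow> 'a::euclidean_space set \<Rightarrow> bool" where
  "smooth_submanifold d M \<longleftrightarrow>
     (\<forall>p\<in>M. \<exists>U V (\<phi>::'a \<Rightarrow> 'a) \<psi> E.
        open U \<and> p \<in> U \<and> open V \<and> homeomorphism U V \<phi> \<psi> \<and>
        smooth_on U \<phi> \<and> smooth_on V \<psi> \<and>
        subspace E \<and> dim E = d \<and> \<phi> ` (M \<inter> U) = E \<inter> V)"

definition tangent_space :: "'a::euclidean_space set \<Rightarrow> 'a \<Rightarrow> 'a set" where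
  "tangent_space M p =
     {v. \<exists>\<gamma> e. 0 < e \<and> smooth_on {-e<..<e::real} \<gamma> \<and> \<gamma> ` {-e<..<e} \<subseteq> M \<and>
             \<gamma> 0 = p \<and> (\<gamma> has_vector_derivative v) (at 0)}"

definition inward_unit_normal :: "'a::euclidean_space set \<Rightarrow> 'a set \<Rightarrow> 'a \<Rightarrow> 'a \<Rightarrow> bool" where
  "inward_unit_normal K H p \<nu> \<longleftrightarrow>
     norm \<nu> = 1 \<and> (\<forall>v\<in>tangent_space H p. \<nu> \<bullet> v = 0) \<and>
     (\<exists>e>0. \<forall>t. 0 < t \<and> t < e \<longrightarrow> p + t *\<^sub>R \<nu> \<in> interior K)"


section \<open>Hypersurfaces around the origin\<close>

definition restricts_origin :: "'a::euclidean_space set \<Rightarrow> 'a set \<Rightarrow> bool" where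
  "restricts_origin G H \<longleftrightarrow>
     smooth_submanifold (DIM('a) - 1) H \<and> compact H \<and> connected H \<and> H \<subseteq> G \<and>
     0 \<notin> H \<and> (\<exists>K. compact K \<and> 0 \<in> K \<and> frontier K = H)"

definition convergent_hypersurfaces ::
    "'a::euclidean_space set \<Rightarrow> (nat \<Rightarrow> 'a set) \<Rightarrow> (nat \<Rightarrow> 'a set) \<Rightarrow> bool" where
  "convergent_hypersurfaces G H K \<longleftrightarrow>
     (\<forall>i. restricts_origin G (H i)) \<and>
     (\<forall>i j. i \<noteq> j \<longrightarrow> H i \<inter> H j = {}) \<and>
     (\<forall>i. compact (K i) \<and> 0 \<in> K i \<and> frontier (K i) = H i) \<and>
     (\<Inter>i. K i) = {0} \<and>
     (\<forall>i j. i < j \<longrightarrow> K j \<subseteq> K i)"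


section \<open>Autonomous systems\<close>

definition solution_on ::
    "'a::real_normed_vector set \<Rightarrow> ('a \<Rightarrow> 'a) \<Rightarrow> real set \<Rightarrow> (real \<Rightarrow> 'a) \<Rightarrow> bool" where
  "solution_on G f J x \<longleftrightarrow>
     is_interval J \<and> x ` J \<subseteq> G \<and>
     (\<forall>t\<in>J. (x has_vector_derivative f (x t)) (at t within J))"

text \<open>
  Since the system is autonomous, initial values may be prescribed at time \<open>0\<close>.
\<close>

definition unique_phase_curves :: "'a::real_normed_vector set \<Rightarrow> ('a \<Rightarrow> 'a) \<Rightarrow> bool" where
  "unique_phase_curves G f \<longleftrightarrow>
     (\<forall>p\<in>G. \<exists>x. \<exists>e>0. solution_on G f {-e<..<e} x \<and> x 0 = p) \<and>
     (\<forall>J J' x y. solution_on G f J x \<and> solution_on G f J' y \<and> 0 \<in> J \<inter> J' \<and> x 0 = y 0 \<longrightarrow>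
        (\<forall>t\<in>J \<inter> J'. x t = y t))"

definition isolated_equilibrium ::
    "'a::real_normed_vector set \<Rightarrow> ('a \<Rightarrow> 'a) \<Rightarrow> 'a \<Rightarrow> bool" where
  "isolated_equilibrium G f p \<longleftrightarrow>
     p \<in> G \<and> f p = 0 \<and> (\<exists>U. open U \<and> p \<in> U \<and> (\<forall>x\<in>U \<inter> G. f x = 0 \<longrightarrow> x = p))"

text \<open>
  Lyapunov stability includes that solutions starting near \<open>p\<close> can be continued to all
  positive times; the estimate is required of every solution, however short its interval.
\<close>

definition lyapunov_stable ::
    "'a::real_normed_vector set \<Rightarrow> ('a \<Rightarrow> 'a) \<Rightarrow> 'a \<Rightarrow> bool" where
  "lyapunov_stable G f p \<longleftrightarrow>
     (\<forall>\<epsilon>>0. \<exists>\<delta>>0. \<forall>x\<^sub>0\<in>G. dist x\<^sub>0 p < \<delta> \<longrightarrow>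
        (\<exists>x. solution_on G f {0..} x \<and> x 0 = x\<^sub>0) \<and>
        (\<forall>J x. solution_on G f J x \<and> 0 \<in> J \<and> x 0 = x\<^sub>0 \<longrightarrow>
           (\<forall>t\<in>J. 0 \<le> t \<longrightarrow> dist (x t) p < \<epsilon>)))"

end

theory Submission
  imports Defs
begin

text \<open>
  Every \<open>K i\<close> is positively invariant. A trajectory that left it would do so at a last point
  \<open>p \<in> H i\<close>, with velocity \<open>f p\<close>. In a chart that flattens \<open>H i\<close> to a hyperplane, a small
  half ball on one side of the hyperplane corresponds to a connected set that misses the frontier
  of \<open>K i\<close>; hence it lies entirely inside or entirely outside \<open>K i\<close>, and the inward normal
  tells which side is inside. Since \<open>f p\<close> has a positive normal component, it points to the same
  side of the tangent hyperplane as the normal, so the trajectory enters the inner side immediately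
  after \<open>p\<close> (\<open>inward_velocity_enters\<close>), a contradiction
  (\<open>forward_invariant_of_inward_field\<close>).

  The rest is topology and continuation. Being decreasing compact sets that shrink to the
  origin, the \<open>K i\<close> eventually lie in any given neighbourhood of it, while each of them
  contains a ball around the origin because the origin is not on its frontier. So trajectories
  from that ball stay in the prescribed neighbourhood. A trajectory confined to a compact
  subset of \<open>G\<close> has bounded velocity and therefore a limit at any finite end time, from
  which the local solution continues it; hence it exists for all positive times
  (\<open>global_solution_in_compact\<close>).
\<close>

section \<open>Curves in a submanifold given by a chart\<close>

text \<open>
  On an open set the derivatives of \<open>f\<close> and \<open>g\<close> agree as well, so the claim passes from
  one order of differentiability to the next.
\<close>
lemma Ck_on_cong_open:
  assumes "open S" "\<And>x. x \<in> S \<Longrightarrow> f x = g x"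
  shows "Ck_on k f S \<Longrightarrow> Ck_on k g S"
  using assms(2)
proof (induction k arbitrary: f g)
  case 0
  then show ?case
    by (metis Ck_on.simps(1) continuous_on_cong)
next
  case (Suc k)
  have diff: "f differentiable (at x)" if "x \<in> S" for x
    using Suc.prems(1) that by simp
  have fre: "frechet_derivative f (at x) = frechet_derivative g (at x)" if "x \<in> S" for x
    by (rule frechet_derivative_transform_within_open[OF diff[OF that] assms(1) that Suc.prems(2)])
  have "g differentiable (at x)" if "x \<in> S" for x
    using diff[OF that] unfolding differentiable_def
    by (meson has_derivative_transform_within_open[OF _ assms(1) that] Suc.prems(2))
  moreover have "Ck_on k (\<lambda>x. frechet_derivative g (at x) v) S" for v
    using Suc.IH[of "\<lambda>x. frechet_derivative f (at x) v"] Suc.prems(1) fre by simp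
  ultimately show ?case
    by simp
qed

text \<open>
  The only instance of the chain rule for higher derivatives that tangent vectors require: each
  derivative along a line is again the restriction of a directional derivative to that line.
\<close>
lemma Ck_on_restrict_to_line:
  fixes \<psi> :: "'a::real_normed_vector \<Rightarrow> 'b::real_normed_vector"
  assumes "open S" "\<And>t. t \<in> S \<Longrightarrow> q + t *\<^sub>R e \<in> V"
  shows "Ck_on k \<psi> V \<Longrightarrow> Ck_on k (\<lambda>t::real. \<psi> (q + t *\<^sub>R e)) S"
proof (induction k arbitrary: \<psi>)
  case 0
  then show ?case
    using assms(2) by (auto intro!: continuous_on_compose2[of V \<psi>] continuous_intros)
next
  case (Suc k)
  have der: "((\<lambda>t. \<psi> (q + t *\<^sub>R e)) has_derivative
      (\<lambda>s. frechet_derivative \<psi> (at (q + t *\<^sub>R e)) (s *\<^sub>R e))) (at t)" if "t \<in> S" for t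
  proof -
    have "(\<psi> has_derivative frechet_derivative \<psi> (at (q + t *\<^sub>R e))) (at (q + t *\<^sub>R e))"
      using Suc.prems assms(2)[OF that] frechet_derivative_works by auto
    moreover have "((\<lambda>t. q + t *\<^sub>R e) has_derivative (\<lambda>s. s *\<^sub>R e)) (at t)"
      by (auto intro!: derivative_eq_intros)
    ultimately show ?thesis
      by (rule has_derivative_compose[rotated])
  qed
  have "Ck_on k (\<lambda>t. frechet_derivative (\<lambda>t. \<psi> (q + t *\<^sub>R e)) (at t) s) S" for s
  proof (rule Ck_on_cong_open[OF assms(1)])
    show "Ck_on k (\<lambda>t. frechet_derivative \<psi> (at (q + t *\<^sub>R e)) (s *\<^sub>R e)) S"
      using Suc.IH[of "\<lambda>x. frechet_derivative \<psi> (at x) (s *\<^sub>R e)"] Suc.prems by simp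
  qed (use der frechet_derivative_at in metis)
  with der show ?case
    by (auto simp: differentiable_def)
qed

text \<open>
  The curve \<open>t \<mapsto> \<psi> (q + t e)\<close> lies in \<open>M\<close> and has velocity \<open>D e\<close> at \<open>t = 0\<close>.
\<close>
lemma chart_direction_in_tangent_space:
  fixes M :: "'a::euclidean_space set"
  assumes "open V" "q \<in> V" "smooth_on V \<psi>"
    and sub: "\<And>t. q + t *\<^sub>R e \<in> V \<Longrightarrow> \<psi> (q + t *\<^sub>R e) \<in> M"
    and D: "(\<psi> has_derivative D) (at q)"
  shows "D e \<in> tangent_space M (\<psi> q)"
proof -
  have "open ((\<lambda>t::real. q + t *\<^sub>R e) -` V)"
    by (intro open_vimage assms continuous_intros)
  then obtain r where r: "r > 0" "ball 0 r \<subseteq> (\<lambda>t::real. q + t *\<^sub>R e) -` V"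
    using assms(2) unfolding open_contains_ball by force
  have ball: "ball 0 r = {-r<..<r}"
    by (auto simp: dist_real_def)
  have in_V: "q + t *\<^sub>R e \<in> V" if "t \<in> {-r<..<r}" for t
    using r(2) that unfolding ball by blast
  have "smooth_on {-r<..<r} (\<lambda>t. \<psi> (q + t *\<^sub>R e))"
    unfolding smooth_on_def
    by (intro allI Ck_on_restrict_to_line[of _ _ _ V])
       (use assms(3) in_V in \<open>auto simp: smooth_on_def\<close>)
  moreover have "((\<lambda>t. \<psi> (q + t *\<^sub>R e)) has_vector_derivative D e) (at 0)"
  proof -
    have "((\<lambda>t. q + t *\<^sub>R e) has_derivative (\<lambda>s. s *\<^sub>R e)) (at (0::real))"
      by (auto intro!: derivative_eq_intros)
    then have "((\<lambda>t. \<psi> (q + t *\<^sub>R e)) has_derivative (\<lambda>s. D (s *\<^sub>R e))) (at (0::real))"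
      by (rule has_derivative_compose) (use D in simp)
    then show ?thesis
      using linear_cmul[OF has_derivative_linear[OF D]] by (simp add: has_vector_derivative_def)
  qed
  ultimately show ?thesis
    unfolding tangent_space_def using r(1) in_V sub
    by (auto intro!: exI[of _ "\<lambda>t. \<psi> (q + t *\<^sub>R e)"] exI[of _ r])
qed

section \<open>Crossing a hypersurface\<close>

text \<open>
  Locally \<open>H\<close> is the zero set of \<open>a \<bullet> \<phi>\<close>, where \<open>\<phi>\<close> is a chart and \<open>a\<close> a normal of the
  hyperplane onto which it flattens \<open>H\<close>. The derivative of this function at \<open>p\<close> is a functional
  whose kernel consists of tangent vectors, so it is a multiple of the inner product with
  \<open>\<nu>\<close>, and it has the same sign at \<open>v\<close> and at \<open>\<nu>\<close>. Hence \<open>c\<close> and the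
  normal ray move to the same side of \<open>H\<close>, and the normal ray shows that this is the side of \<open>K\<close>.
  Times are taken within \<open>S\<close> so that the lemma also covers one-sided derivatives.
\<close>
lemma inward_velocity_enters:
  fixes H K :: "'a::euclidean_space set" and c :: "real \<Rightarrow> 'a"
  assumes "smooth_submanifold (DIM('a) - 1) H" "frontier K = H" "p \<in> H"
    and normal: "inward_unit_normal K H p \<nu>" and "v \<bullet> \<nu> > 0"
    and c: "(c has_vector_derivative v) (at t0 within S)" "c t0 = p"
  shows "\<exists>d>0. \<forall>h. 0 < h \<and> h < d \<and> t0 + h \<in> S \<longrightarrow> c (t0 + h) \<in> K"
proof -
  obtain U V \<phi> \<psi> and E :: "'a set" where chart: "open U" "p \<in> U" "open V" "homeomorphism U V \<phi> \<psi>"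
      "smooth_on U \<phi>" "smooth_on V \<psi>" "subspace E" "dim E = DIM('a) - 1" "\<phi> ` (H \<inter> U) = E \<inter> V"
    using assms(1,3) unfolding smooth_submanifold_def by meson
  have hom: "\<And>x. x \<in> U \<Longrightarrow> \<psi> (\<phi> x) = x" "\<And>x. x \<in> U \<Longrightarrow> \<phi> x \<in> V"
    "\<And>y. y \<in> V \<Longrightarrow> \<phi> (\<psi> y) = y" "\<And>y. y \<in> V \<Longrightarrow> \<psi> y \<in> U"
    using chart(4) by (auto simp: homeomorphism_def)
  define q where "q = \<phi> p"
  have q: "q \<in> V" "\<psi> q = p" "q \<in> E"
    using hom chart(2,9) assms(3) by (auto simp: q_def)
  have "Ck_on (Suc 0) \<phi> U" "Ck_on (Suc 0) \<psi> V"
    using chart(5,6) unfolding smooth_on_def by blast+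
  then obtain A B where A: "(\<phi> has_derivative A) (at p)" and B: "(\<psi> has_derivative B) (at q)"
    using chart(2) q(1) unfolding Ck_on.simps differentiable_def by blast
  have "((\<lambda>x. \<psi> (\<phi> x)) has_derivative (\<lambda>x. B (A x))) (at p)"
    using has_derivative_compose[OF A] B by (simp add: q_def)
  then have "((\<lambda>x. x) has_derivative (\<lambda>x. B (A x))) (at p)"
    by (rule has_derivative_transform_within_open[OF _ chart(1,2) hom(1)])
  then have BA: "B (A w) = w" for w
    by (metis has_derivative_unique has_derivative_ident)
  obtain a0 where a0: "E = {x. a0 \<bullet> x = 0}"
    using lowdim_eq_hyperplane[OF chart(8)] chart(7) by (metis span_eq_iff)
  \<comment> \<open>Orient the defining covector so that \<open>a \<bullet> \<phi>\<close> increases along \<open>\<nu>\<close>.\<close>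
  define a where "a = (if a0 \<bullet> A \<nu> < 0 then - a0 else a0)"
  have E: "E = {x. a \<bullet> x = 0}" and a_nonneg: "a \<bullet> A \<nu> \<ge> 0"
    by (auto simp: a0 a_def)
  have in_H: "\<psi> y \<in> H \<longleftrightarrow> a \<bullet> y = 0" if "y \<in> V" for y
  proof
    assume "\<psi> y \<in> H"
    then have "\<phi> (\<psi> y) \<in> \<phi> ` (H \<inter> U)"
      using hom(4)[OF that] by blast
    then show "a \<bullet> y = 0"
      by (simp add: chart(9) hom(3)[OF that] E)
  next
    assume "a \<bullet> y = 0"
    then have "y \<in> \<phi> ` (H \<inter> U)"
      using that by (simp add: chart(9) E)
    then show "\<psi> y \<in> H"
      using hom(1) by auto
  qed
  have linA: "linear A"
    using A by (rule has_derivative_linear)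
  \<comment> \<open>As \<open>w = B (A w)\<close>, a vector whose image lies in the flat hyperplane is tangent to \<open>H\<close>.\<close>
  have orth: "\<nu> \<bullet> w = 0" if "a \<bullet> A w = 0" for w
  proof -
    have "B (A w) \<in> tangent_space H (\<psi> q)"
    proof (rule chart_direction_in_tangent_space[OF chart(3) q(1) chart(6) _ B])
      show "\<psi> (q + t *\<^sub>R A w) \<in> H" if "q + t *\<^sub>R A w \<in> V" for t
        using in_H[OF that] \<open>a \<bullet> A w = 0\<close> q(3) by (simp add: E inner_add_right)
    qed
    then show ?thesis
      using normal by (simp add: BA q(2) inward_unit_normal_def)
  qed
  have \<nu>: "\<nu> \<bullet> \<nu> = 1"
    using normal by (simp add: inward_unit_normal_def norm_eq_1)
  then have pos_\<nu>: "a \<bullet> A \<nu> > 0"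
    using orth[of \<nu>] a_nonneg by fastforce
  have pos_v: "a \<bullet> A v > 0"
  proof -
    \<comment> \<open>Subtract from \<open>v\<close> the multiple of \<open>\<nu>\<close> that leaves a tangent vector.\<close>
    define m where "m = a \<bullet> A v / (a \<bullet> A \<nu>)"
    have "a \<bullet> A (v - m *\<^sub>R \<nu>) = 0"
      using pos_\<nu> by (simp add: m_def linear_diff[OF linA] linear_cmul[OF linA] inner_diff_right)
    then have "\<nu> \<bullet> v = m"
      using orth \<nu> by (fastforce simp: inner_diff_right)
    then show ?thesis
      using assms(5) pos_\<nu> by (simp add: m_def inner_commute zero_less_divide_iff)
  qed
  obtain r where r: "r > 0" "ball q r \<subseteq> V"
    using chart(3) q(1) by (meson open_contains_ball)
  \<comment> \<open>A half ball, chosen for being connected and disjoint from the flattened hypersurface.\<close>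
  define side where "side = ball q r \<inter> {y. a \<bullet> y > 0}"
  have lands: "\<exists>d>0. \<forall>h. 0 < h \<and> h < d \<and> s + h \<in> T \<longrightarrow> b (s + h) \<in> \<psi> ` side"
    if b: "(b has_vector_derivative w) (at s within T)" "b s = p" and "a \<bullet> A w > 0"
    for b :: "real \<Rightarrow> 'a" and w s T
  proof -
    have "((\<lambda>t. \<phi> (b t)) has_derivative (\<lambda>t. A (t *\<^sub>R w))) (at s within T)"
      by (rule has_derivative_compose[OF b(1)[unfolded has_vector_derivative_def]])
         (simp add: b(2) A)
    then have "((\<lambda>t. a \<bullet> \<phi> (b t)) has_derivative (\<lambda>t. a \<bullet> A (t *\<^sub>R w))) (at s within T)"
      by (rule has_derivative_inner_right)
    then have "((\<lambda>t. a \<bullet> \<phi> (b t)) has_real_derivative a \<bullet> A w) (at s within T)"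
      by (simp add: has_field_derivative_def linear_cmul[OF linA] mult.commute[of _ "a \<bullet> A w"])
    from has_real_derivative_pos_inc_right[OF this that(3)]
    obtain d1 where d1: "d1 > 0" "\<And>h. 0 < h \<Longrightarrow> s + h \<in> T \<Longrightarrow> h < d1 \<Longrightarrow> 0 < a \<bullet> \<phi> (b (s + h))"
      using q(3) b(2) by (auto simp: E q_def)
    have open_pre: "open (U \<inter> \<phi> -` ball q r)"
      using chart(1,4) by (intro continuous_open_preimage) (auto simp: homeomorphism_def)
    have "continuous (at s within T) b"
      using b(1) by (auto simp: has_vector_derivative_def intro: has_derivative_continuous)
    then have "\<forall>\<^sub>F t in at s within T. b t \<in> U \<inter> \<phi> -` ball q r"
      unfolding continuous_within
      by (rule topological_tendstoD) (use open_pre r(1) chart(2) b(2) in \<open>auto simp: q_def\<close>)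
    then obtain d2 where d2: "d2 > 0"
        "\<And>t. t \<in> T \<Longrightarrow> t \<noteq> s \<Longrightarrow> dist t s < d2 \<Longrightarrow> b t \<in> U \<inter> \<phi> -` ball q r"
      unfolding eventually_at by blast
    have "b (s + h) \<in> \<psi> ` side" if "0 < h" "h < min d1 d2" "s + h \<in> T" for h
    proof (rule image_eqI)
      have *: "b (s + h) \<in> U \<inter> \<phi> -` ball q r"
        using d2(2)[of "s + h"] that by (simp add: dist_real_def)
      then show "b (s + h) = \<psi> (\<phi> (b (s + h)))"
        using hom(1) by simp
      show "\<phi> (b (s + h)) \<in> side"
        using * d1(2) that by (simp add: side_def)
    qed
    then show ?thesis
      using d1(1) d2(1) by (intro exI[of _ "min d1 d2"]) auto
  qed
  have "\<psi> ` side \<inter> frontier K = {}"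
    using in_H r(2) by (auto simp: side_def assms(2))
  moreover have "connected (\<psi> ` side)"
  proof (rule connected_continuous_image)
    show "continuous_on side \<psi>"
      using chart(4) r(2) by (auto simp: homeomorphism_def side_def intro: continuous_on_subset)
    show "connected side"
      unfolding side_def by (intro convex_connected convex_Int convex_ball convex_halfspace_gt)
  qed
  moreover have "\<psi> ` side \<inter> K \<noteq> {}"
  proof -
    have "((\<lambda>t. p + t *\<^sub>R \<nu>) has_vector_derivative \<nu>) (at 0 within UNIV)"
      by (auto intro!: derivative_eq_intros)
    from lands[OF this _ pos_\<nu>] obtain d where d: "d > 0"
      "\<And>h. 0 < h \<Longrightarrow> h < d \<Longrightarrow> p + h *\<^sub>R \<nu> \<in> \<psi> ` side"
      by auto
    obtain e where e: "e > 0" "\<And>t. 0 < t \<Longrightarrow> t < e \<Longrightarrow> p + t *\<^sub>R \<nu> \<in> interior K"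
      using normal by (auto simp: inward_unit_normal_def)
    define h where "h = min d e / 2"
    have "0 < h" "h < d" "h < e"
      using d(1) e(1) by (auto simp: h_def)
    then show ?thesis
      using d(2) e(2) interior_subset by blast
  qed
  ultimately have "\<psi> ` side \<subseteq> K"
    using connected_Int_frontier by blast
  then show ?thesis
    using lands[OF c pos_v] by blast
qed


section \<open>Restricting solutions\<close>

lemma solution_on_continuous: "solution_on G f J x \<Longrightarrow> continuous_on J x"
  unfolding solution_on_def continuous_on_eq_continuous_within
  by (metis has_derivative_continuous has_vector_derivative_def)

lemma solution_on_derivative_at:
  assumes "solution_on G f J x" "open I" "t \<in> I" "I \<subseteq> J"
  shows "(x has_vector_derivative f (x t)) (at t)"
proof -
  have "(x has_vector_derivative f (x t)) (at t within J)"
    using assms unfolding solution_on_def by blast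
  then have "(x has_vector_derivative f (x t)) (at t within I)"
    by (rule has_vector_derivative_within_subset[OF _ assms(4)])
  then show ?thesis
    by (simp add: at_within_open[OF assms(3,2)])
qed

lemma solution_on_subset:
  "solution_on G f J x \<Longrightarrow> is_interval I \<Longrightarrow> I \<subseteq> J \<Longrightarrow> solution_on G f I x"
  unfolding solution_on_def by (meson has_vector_derivative_within_subset image_mono order_trans subsetD)

lemma solution_on_cong:
  assumes "solution_on G f J x" "\<And>t. t \<in> J \<Longrightarrow> x t = y t"
  shows "solution_on G f J y"
  using assms unfolding solution_on_def
  by (metis has_vector_derivative_transform image_cong)

section \<open>Forward invariance\<close>

text \<open>
  At the last time \<open>s\<close> in \<open>K\<close> before the trajectory is outside, it sits on the frontier, and
  the inward velocity there would bring it into \<open>K\<close> right after \<open>s\<close>.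
\<close>
lemma forward_invariant_of_inward_field:
  fixes H K :: "'a::euclidean_space set"
  assumes "smooth_submanifold (DIM('a) - 1) H" "frontier K = H" "closed K"
    and normal: "\<And>x. x \<in> H \<Longrightarrow> inward_unit_normal K H x (N x)"
    and inward: "\<And>x. x \<in> H \<Longrightarrow> N x \<bullet> f x > 0"
    and sol: "solution_on G f J x" and "0 \<in> J" "x 0 \<in> K" "t \<in> J" "0 \<le> t"
  shows "x t \<in> K"
proof (rule ccontr)
  assume out: "x t \<notin> K"
  have sub: "{0..t} \<subseteq> J"
    using sol \<open>0 \<in> J\<close> \<open>t \<in> J\<close> unfolding solution_on_def
    by (meson atLeastAtMost_iff mem_is_interval_1_I subsetI)
  have sol_t: "solution_on G f {0..t} x"
    by (rule solution_on_subset[OF sol _ sub]) (simp add: is_interval_cc)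
  then have der: "(x has_vector_derivative f (x s)) (at s within {0..t})" if "s \<in> {0..t}" for s
    using that by (simp add: solution_on_def)
  have cont: "continuous_on {0..t} x"
    by (rule solution_on_continuous[OF sol_t])
  define A where "A = {0..t} \<inter> x -` K"
  define s where "s = Sup A"
  have "closed A"
    unfolding A_def by (rule continuous_closed_preimage[OF cont closed_atLeastAtMost \<open>closed K\<close>])
  moreover have bdd: "bdd_above A"
    by (rule bdd_aboveI[of _ t]) (simp add: A_def)
  moreover have "A \<noteq> {}"
    using assms(8,10) by (auto simp: A_def)
  ultimately have "s \<in> A"
    unfolding s_def by (intro closed_contains_Sup)
  have max: "u \<le> s" if "u \<in> A" for u
    unfolding s_def by (rule cSup_upper[OF that bdd])
  from \<open>s \<in> A\<close> have s: "0 \<le> s" "s \<le> t" "x s \<in> K"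
    by (auto simp: A_def)
  with out have "s < t"
    by (cases "s = t") auto
  have after: "x u \<notin> K" if "s < u" "u \<le> t" for u
    using max[of u] that s by (auto simp: A_def)
  have "x s \<notin> interior K"
  proof
    assume "x s \<in> interior K"
    moreover have "(x \<longlongrightarrow> x s) (at s within {0..t})"
      using cont s by (simp add: continuous_on_def)
    ultimately have "\<forall>\<^sub>F u in at s within {0..t}. x u \<in> interior K"
      by (intro topological_tendstoD) auto
    then obtain d where d: "d > 0" "\<And>u. u \<in> {0..t} \<Longrightarrow> u \<noteq> s \<Longrightarrow> dist u s < d \<Longrightarrow> x u \<in> interior K"
      unfolding eventually_at by blast
    define u where "u = s + min (d/2) (t - s)"
    have "s < u" "u \<le> t" "dist u s < d"
      using d(1) \<open>s < t\<close> by (auto simp: u_def dist_real_def)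
    then show False
      using d(2)[of u] after[of u] s interior_subset by fastforce
  qed
  then have "x s \<in> H"
    using s(3) assms(3) by (auto simp: assms(2)[symmetric] frontier_def)
  have v: "f (x s) \<bullet> N (x s) > 0"
    using inward[OF \<open>x s \<in> H\<close>] by (simp add: inner_commute)
  have "(x has_vector_derivative f (x s)) (at s within {0..t})"
    by (rule der) (use s in simp)
  from inward_velocity_enters[OF assms(1,2) \<open>x s \<in> H\<close> normal[OF \<open>x s \<in> H\<close>] v this refl]
  obtain d where d: "d > 0"
      "\<And>h. 0 < h \<Longrightarrow> h < d \<Longrightarrow> s + h \<in> {0..t} \<Longrightarrow> x (s + h) \<in> K"
    by blast
  define h where "h = min (d/2) (t - s)"
  have "0 < h" "h < d" "s + h \<le> t"
    using d(1) \<open>s < t\<close> by (auto simp: h_def)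
  then show False
    using d(2)[of h] after[of "s + h"] s by auto
qed

section \<open>Solutions confined to a compact set\<close>

text \<open>
  Passing to \<open>J \<inter> {..u}\<close> with \<open>u > t\<close> does not change the neighbourhoods of \<open>t\<close>
  in \<open>J\<close>, so the derivative at \<open>t\<close> is not affected.
\<close>
lemma solution_on_exhaustion:
  assumes "is_interval J"
    and "\<And>t. t \<in> J \<Longrightarrow> \<exists>u>t. solution_on G f (J \<inter> {..u}) x"
  shows "solution_on G f J x"
proof -
  have "x t \<in> G \<and> (x has_vector_derivative f (x t)) (at t within J)" if t: "t \<in> J" for t
  proof -
    obtain u where u: "t < u" "solution_on G f (J \<inter> {..u}) x"
      using assms(2)[OF t] by blast
    have "at t within (J \<inter> {..u}) = at t within J"
      by (rule at_within_nhd[of _ "{..<u}"]) (use u in auto)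
    moreover have "t \<in> J \<inter> {..u}"
      using u(1) t by simp
    ultimately show ?thesis
      using u(2) unfolding solution_on_def by (metis image_subset_iff)
  qed
  then show ?thesis
    using assms(1) by (auto simp: solution_on_def)
qed

text \<open>
  A continuous curve that satisfies the equation up to finitely many times satisfies the
  equivalent integral equation, and differentiating the integral gives the equation
  at the exceptional times and at the endpoints. This serves both for adding an endpoint
  and for joining two solutions.
\<close>
lemma solution_on_Icc_of_interior:
  fixes f :: "'a::banach \<Rightarrow> 'a"
  assumes f: "continuous_on G f" and x: "continuous_on {a..b} x" "x ` {a..b} \<subseteq> G"
    and "finite D"
    and der: "\<And>t. t \<in> {a<..<b} - D \<Longrightarrow> (x has_vector_derivative f (x t)) (at t)"
  shows "solution_on G f {a..b} x"
proof -
  have cont: "continuous_on {a..b} (\<lambda>t. f (x t))"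
    by (rule continuous_on_compose2[OF f x])
  have int: "x u = x a + integral {a..u} (\<lambda>t. f (x t))" if "u \<in> {a..b}" for u
  proof -
    have "((\<lambda>t. f (x t)) has_integral (x u - x a)) {a..u}"
      by (rule fundamental_theorem_of_calculus_interior_strong[OF \<open>finite D\<close>])
         (use that der x(1) in \<open>auto intro: continuous_on_subset\<close>)
    then show ?thesis
      by (simp add: integral_unique)
  qed
  have "(x has_vector_derivative f (x t)) (at t within {a..b})" if "t \<in> {a..b}" for t
  proof (rule has_vector_derivative_transform[OF that])
    show "((\<lambda>u. x a + integral {a..u} (\<lambda>t. f (x t))) has_vector_derivative f (x t)) (at t within {a..b})"
      using has_vector_derivative_add[OF has_vector_derivative_const
          integral_has_vector_derivative[OF cont that], of "x a"] by simp
  qed (rule int)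
  then show ?thesis
    using x(2) by (simp add: solution_on_def is_interval_cc)
qed

text \<open>
  The velocity is bounded on the compact set, so the solution is Lipschitz, hence uniformly
  continuous, and extends continuously to the endpoint.
\<close>
lemma solution_extends_to_endpoint:
  fixes f :: "'a::euclidean_space \<Rightarrow> 'a"
  assumes f: "continuous_on G f" and K: "compact K" "K \<subseteq> G"
    and sol: "solution_on G f {a..<b} x" and in_K: "x ` {a..<b} \<subseteq> K" and "a < b"
  shows "\<exists>y. solution_on G f {a..b} y \<and> (\<forall>t\<in>{a..<b}. y t = x t)"
proof -
  have der: "(x has_vector_derivative f (x t)) (at t within {a..<b})" if "t \<in> {a..<b}" for t
    using sol that by (auto simp: solution_on_def)
  have "bounded (f ` K)"
    using K f by (meson compact_continuous_image compact_imp_bounded continuous_on_subset)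
  then obtain C where C: "C > 0" "\<And>p. p \<in> K \<Longrightarrow> norm (f p) \<le> C"
    unfolding bounded_pos by auto
  have "C-lipschitz_on {a..<b} x"
  proof (rule bounded_derivative_imp_lipschitz)
    show "(x has_derivative (\<lambda>h. h *\<^sub>R f (x t))) (at t within {a..<b})" if "t \<in> {a..<b}" for t
      using der[OF that] by (simp add: has_vector_derivative_def)
    show "onorm (\<lambda>h. h *\<^sub>R f (x t)) \<le> C" if "t \<in> {a..<b}" for t
    proof (rule onorm_le)
      have "x t \<in> K"
        using in_K that by blast
      then show "norm (h *\<^sub>R f (x t)) \<le> C * norm h" for h
        using mult_left_mono[OF C(2), of "x t" "\<bar>h\<bar>"] by (simp add: mult.commute)
    qed
  qed (use C(1) in \<open>auto simp: convex_real_interval\<close>)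
  then obtain y where y: "uniformly_continuous_on (closure {a..<b}) y" "\<And>t. t \<in> {a..<b} \<Longrightarrow> x t = y t"
    using uniformly_continuous_on_extension_on_closure lipschitz_on_uniformly_continuous by metis
  have cont: "continuous_on {a..b} y"
    using y(1) \<open>a < b\<close> by (simp add: uniformly_continuous_imp_continuous)
  have "y ` closure {a..<b} \<subseteq> K"
    by (rule image_closure_subset) (use cont \<open>a < b\<close> K(1) in_K y(2) in \<open>auto simp: compact_imp_closed\<close>)
  then have "y ` {a..b} \<subseteq> G"
    using K(2) \<open>a < b\<close> by auto
  moreover have "(y has_vector_derivative f (y t)) (at t)" if "t \<in> {a<..<b}" for t
  proof -
    have "(x has_vector_derivative f (x t)) (at t)"
      by (rule solution_on_derivative_at[OF sol open_greaterThanLessThan that]) auto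
    then show ?thesis
      using has_vector_derivative_transform_within_open[of x "f (x t)" t "{a<..<b}" y] y(2) that by simp
  qed
  ultimately have "solution_on G f {a..b} y"
    by (intro solution_on_Icc_of_interior[OF f cont _ finite.emptyI]) auto
  then show ?thesis
    using y(2) by auto
qed

text \<open>
  The system is autonomous, so \<open>z\<close> may be shifted in time to start at \<open>b\<close> and appended to \<open>x\<close>.
\<close>
lemma solution_extends_beyond_endpoint:
  fixes f :: "'a::euclidean_space \<Rightarrow> 'a"
  assumes f: "continuous_on G f" and sol: "solution_on G f {a..b} x" and "a \<le> b"
    and loc: "solution_on G f {-e<..<e} z" "z 0 = x b" "e > 0"
  shows "\<exists>y c. b < c \<and> solution_on G f {a..c} y \<and> y a = x a"
proof -
  \<comment> \<open>Half of \<open>e\<close>, because \<open>z\<close> need not extend to the end of its open interval.\<close>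
  define c where "c = b + e / 2"
  define y where "y = (\<lambda>t. if t \<le> b then x t else z (t - b))"
  have cx: "continuous_on {a..b} x"
    by (rule solution_on_continuous[OF sol])
  have cz: "continuous_on {-e<..<e} z"
    by (rule solution_on_continuous[OF loc(1)])
  have cont: "continuous_on {a..c} y"
    unfolding y_def
  proof (rule continuous_on_cases_le)
    show "continuous_on {t \<in> {a..c}. t \<le> b} x"
      by (rule continuous_on_subset[OF cx]) auto
    show "continuous_on {t \<in> {a..c}. b \<le> t} (\<lambda>t. z (t - b))"
      by (rule continuous_on_compose2[OF cz])
         (use loc(3) in \<open>auto simp: c_def intro!: continuous_intros\<close>)
  qed (use loc(2) in \<open>auto intro: continuous_intros\<close>)
  have "y ` {a..c} \<subseteq> G"
  proof (rule image_subsetI)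
    fix t assume t: "t \<in> {a..c}"
    have "x t \<in> G" if "t \<le> b"
      using sol t that by (auto simp: solution_on_def)
    moreover have "z (t - b) \<in> G" if "\<not> t \<le> b"
    proof -
      have "t - b \<in> {-e<..<e}"
        using t that loc(3) by (auto simp: c_def)
      then show ?thesis
        using loc(1) by (auto simp: solution_on_def)
    qed
    ultimately show "y t \<in> G"
      by (simp add: y_def)
  qed
  moreover have "(y has_vector_derivative f (y t)) (at t)" if t: "t \<in> {a<..<c} - {b}" for t
  proof (cases "t < b")
    case True
    have tab: "t \<in> {a<..<b}"
      using t True by auto
    have "(x has_vector_derivative f (x t)) (at t)"
      by (rule solution_on_derivative_at[OF sol open_greaterThanLessThan tab]) auto
    then show ?thesis
      using has_vector_derivative_transform_within_open[of x "f (x t)" t "{a<..<b}" y] tab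
      by (simp add: y_def)
  next
    case False
    then have "b < t"
      using t by auto
    have te: "t - b \<in> {-e<..<e}"
      using t \<open>b < t\<close> loc(3) by (auto simp: c_def)
    have "(z has_vector_derivative f (z (t - b))) (at (t - b))"
      by (rule solution_on_derivative_at[OF loc(1) open_greaterThanLessThan te order.refl])
    then have "((z \<circ> (\<lambda>t. t - b)) has_vector_derivative 1 *\<^sub>R f (z (t - b))) (at t)"
      by (intro vector_diff_chain_at) (auto intro!: derivative_eq_intros)
    then have "((\<lambda>t. z (t - b)) has_vector_derivative f (z (t - b))) (at t)"
      by (simp add: o_def)
    then have "(y has_vector_derivative f (z (t - b))) (at t)"
      by (rule has_vector_derivative_transform_within_open[of _ _ _ "{b<..}"])
         (use \<open>b < t\<close> in \<open>auto simp: y_def\<close>)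
    then show ?thesis
      using \<open>b < t\<close> by (simp add: y_def)
  qed
  ultimately have "solution_on G f {a..c} y"
    by (intro solution_on_Icc_of_interior[OF f cont, of "{b}"]) auto
  then show ?thesis
    using loc(3) \<open>a \<le> b\<close> by (intro exI[of _ y] exI[of _ c]) (auto simp: c_def y_def)
qed

text \<open>
  The end times \<open>T\<close> for which a solution on \<open>{0..T}\<close> exists form an interval starting at \<open>0\<close>
  that has no greatest element and, by confinement to \<open>K\<close>, contains its supremum if that is
  finite. So it is unbounded, and uniqueness lets the solutions on the intervals \<open>{0..T}\<close>
  be glued.
\<close>
lemma global_solution_in_compact:
  fixes f :: "'a::euclidean_space \<Rightarrow> 'a"
  assumes f: "continuous_on G f" and uniq: "unique_phase_curves G f"
    and K: "compact K" "K \<subseteq> G" and "x0 \<in> K"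
    and confined: "\<And>J x t. solution_on G f J x \<Longrightarrow> 0 \<in> J \<Longrightarrow> x 0 = x0 \<Longrightarrow> t \<in> J \<Longrightarrow> 0 \<le> t \<Longrightarrow> x t \<in> K"
  shows "\<exists>x. solution_on G f {0..} x \<and> x 0 = x0"
proof -
  have local: "\<exists>z e. e > 0 \<and> solution_on G f {-e<..<e} z \<and> z 0 = p" if "p \<in> G" for p
    using uniq that unfolding unique_phase_curves_def by blast
  define reach where "reach T x \<longleftrightarrow> solution_on G f {0..T} x \<and> x 0 = x0" for T x
  define A where "A = {T. 0 \<le> T \<and> (\<exists>x. reach T x)}"
  define F where "F T = (SOME x. reach T x)" for T
  have F: "solution_on G f {0..T} (F T)" "F T 0 = x0" if "T \<in> A" for T
    using that someI_ex[of "reach T"] by (auto simp: A_def F_def reach_def)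
  \<comment> \<open>The diagonal glues the chosen solutions; by uniqueness it agrees with each of them.\<close>
  define X where "X t = F t t" for t
  have XF: "X t = F T t" if "T \<in> A" "0 \<le> t" "t \<in> A" "t \<le> T" for t T
  proof -
    have "0 \<in> {0..t} \<inter> {0..T}" "t \<in> {0..t} \<inter> {0..T}" "F t 0 = F T 0"
      using that F(2) by auto
    then have "F t t = F T t"
      using uniq F(1)[OF \<open>t \<in> A\<close>] F(1)[OF \<open>T \<in> A\<close>] unfolding unique_phase_curves_def by blast
    then show ?thesis
      by (simp add: X_def)
  qed
  have down: "t \<in> A" if "T \<in> A" "0 \<le> t" "t \<le> T" for t T
  proof -
    have "reach t (F T)"
      using F[OF that(1)] that unfolding reach_def
      by (auto intro: solution_on_subset simp: is_interval_cc)
    then show ?thesis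
      using that by (auto simp: A_def)
  qed
  have "0 \<in> A"
  proof -
    obtain z e where "e > (0::real)" "solution_on G f {-e<..<e} z" "z 0 = x0"
      using local \<open>x0 \<in> K\<close> K(2) by blast
    then have "reach 0 z"
      using solution_on_subset[of G f "{-e<..<e}" z "{0..0}"] is_interval_cc[of 0 0]
      by (simp add: reach_def)
    then show ?thesis
      by (auto simp: A_def)
  qed
  then have X0: "X 0 = x0"
    using F(2) by (simp add: X_def)
  have X_sol: "solution_on G f {0..T} X" if "T \<in> A" for T
    by (rule solution_on_cong[OF F(1)[OF that]]) (use XF[OF that] down[OF that] in auto)
  have grow: "\<exists>T'>T. T' \<in> A" if T: "T \<in> A" for T
  proof -
    have "0 \<le> T"
      using T by (simp add: A_def)
    then have "X T \<in> G"
      using X_sol[OF T] by (auto simp: solution_on_def)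
    then obtain z e where "e > (0::real)" "solution_on G f {-e<..<e} z" "z 0 = X T"
      using local by blast
    then obtain y c where "T < c" "solution_on G f {0..c} y" "y 0 = X 0"
      using solution_extends_beyond_endpoint[OF f X_sol[OF T] \<open>0 \<le> T\<close>] by blast
    then show ?thesis
      using \<open>0 \<le> T\<close> X0 by (intro exI[of _ c]) (auto simp: A_def reach_def)
  qed
  have limit: "T \<in> A" if "0 < T" and below: "\<And>t. 0 \<le> t \<Longrightarrow> t < T \<Longrightarrow> t \<in> A" for T
  proof -
    have sol: "solution_on G f {0..<T} X"
    proof (rule solution_on_exhaustion)
      fix t assume t: "t \<in> {0..<T}"
      then obtain u where u: "t < u" "u < T"
        using dense by auto
      then have "{0..<T} \<inter> {..u} = {0..u}"
        by auto
      then show "\<exists>u>t. solution_on G f ({0..<T} \<inter> {..u}) X"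
        using u t X_sol[of u] below[of u] by (intro exI[of _ u]) auto
    qed (simp add: is_interval_co)
    have "X ` {0..<T} \<subseteq> K"
      using confined[OF sol _ X0] \<open>0 < T\<close> by auto
    from solution_extends_to_endpoint[OF f K sol this \<open>0 < T\<close>]
    obtain y where "solution_on G f {0..T} y" "\<forall>t\<in>{0..<T}. y t = X t"
      by blast
    then have "reach T y"
      using \<open>0 < T\<close> X0 by (simp add: reach_def)
    then show ?thesis
      using \<open>0 < T\<close> by (auto simp: A_def)
  qed
  have "\<not> bdd_above A"
  proof
    assume bdd: "bdd_above A"
    define T where "T = Sup A"
    have upper: "t \<le> T" if "t \<in> A" for t
      unfolding T_def by (rule cSup_upper[OF that bdd])
    have "0 < T"
      using grow[OF \<open>0 \<in> A\<close>] upper by force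
    have "T \<in> A"
    proof (rule limit[OF \<open>0 < T\<close>])
      fix t assume "0 \<le> t" "t < T"
      then obtain s where "s \<in> A" "t < s"
        unfolding T_def using less_cSup_iff[OF _ bdd] \<open>0 \<in> A\<close> by blast
      then show "t \<in> A"
        using down \<open>0 \<le> t\<close> by force
    qed
    then show False
      using grow upper by fastforce
  qed
  then have all: "T \<in> A" if "0 \<le> T" for T
    using down that unfolding bdd_above_def by (metis linear)
  have "solution_on G f {0..} X"
  proof (rule solution_on_exhaustion)
    fix t :: real assume "t \<in> {0..}"
    moreover have "{0..} \<inter> {..t + 1} = {0..t + 1}"
      by auto
    ultimately show "\<exists>u>t. solution_on G f ({0..} \<inter> {..u}) X"
      using X_sol all by (intro exI[of _ "t + 1"]) auto
  qed (simp add: is_interval_ci)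
  then show ?thesis
    using X0 by blast
qed

section \<open>Lyapunov stability\<close>

lemma decreasing_compacts_eventually_in_open:
  fixes K :: "nat \<Rightarrow> 'a::heine_borel set"
  assumes compact: "\<And>i. compact (K i)" and decr: "\<And>i j. i < j \<Longrightarrow> K j \<subseteq> K i"
    and "(\<Inter>i. K i) \<subseteq> U" "open U"
  shows "\<exists>i. K i \<subseteq> U"
proof (rule ccontr)
  assume outside: "\<nexists>i. K i \<subseteq> U"
  have "\<Inter>(range (\<lambda>i. K i - U)) \<noteq> {}"
  proof (rule compact_nest)
    show "compact (K i - U)" for i
      by (rule compact_diff[OF compact \<open>open U\<close>])
    show "K i - U \<noteq> {}" for i
      using outside by (metis Diff_eq_empty_iff)
    show "K n - U \<subseteq> K m - U" if "m \<le> n" for m n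
      using decr[of m n] that by (cases "m = n") auto
  qed
  then obtain x where x: "x \<in> (\<Inter>i. K i - U)"
    by (meson ex_in_conv)
  then have "x \<in> K i" "x \<notin> U" for i
    by (simp_all only: INT_iff Diff_iff UNIV_I simp_thms)
  then have "x \<in> (\<Inter>i. K i)" "x \<notin> U"
    by simp_all
  then show False
    using \<open>(\<Inter>i. K i) \<subseteq> U\<close> by (meson subsetD)
qed

theorem theorem3p1:
  fixes G :: "(real ^ 'n) set"
    and f :: "real ^ 'n \<Rightarrow> real ^ 'n"
    and H K :: "nat \<Rightarrow> (real ^ 'n) set"
    and N :: "nat \<Rightarrow> real ^ 'n \<Rightarrow> real ^ 'n"
  assumes "0 \<in> interior G"
    and "continuous_on G f"
    and "unique_phase_curves G f"
    and "isolated_equilibrium G f 0"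
    and "convergent_hypersurfaces G H K"
    and "\<And>i x. x \<in> H i \<Longrightarrow> inward_unit_normal (K i) (H i) x (N i x)"
    and "\<And>i x. x \<in> H i \<Longrightarrow> N i x \<bullet> f x > 0"
  shows "lyapunov_stable G f 0"
  unfolding lyapunov_stable_def
proof (intro allI impI)
  fix \<epsilon> :: real assume "\<epsilon> > 0"
  have "restricts_origin G (H i)" for i
    using assms(5) by (simp add: convergent_hypersurfaces_def)
  then have H: "smooth_submanifold (DIM(real ^ 'n) - 1) (H i)" "0 \<notin> H i" for i
    by (simp_all add: restricts_origin_def)
  have K: "compact (K i)" "0 \<in> K i" "frontier (K i) = H i" for i
    using assms(5) by (simp_all add: convergent_hypersurfaces_def)
  have "\<exists>i. K i \<subseteq> ball 0 \<epsilon> \<inter> interior G"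
  proof (rule decreasing_compacts_eventually_in_open[OF K(1)])
    show "K j \<subseteq> K i" if "i < j" for i j
      using assms(5) that by (simp add: convergent_hypersurfaces_def)
    have "(\<Inter>i. K i) = {0}"
      using assms(5) by (simp add: convergent_hypersurfaces_def)
    then show "(\<Inter>i. K i) \<subseteq> ball 0 \<epsilon> \<inter> interior G"
      using assms(1) \<open>\<epsilon> > 0\<close> by simp
  qed (simp add: open_Int)
  then obtain i where i: "K i \<subseteq> ball 0 \<epsilon>" "K i \<subseteq> G"
    using interior_subset by blast
  have "0 \<in> interior (K i)"
    using H(2)[of i] K[of i] closure_subset by (auto simp: frontier_def)
  then obtain \<delta> where \<delta>: "\<delta> > 0" "ball 0 \<delta> \<subseteq> K i"
    by (auto simp: mem_interior)
  have invariant: "x t \<in> K i"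
    if "solution_on G f J x" "0 \<in> J" "x 0 = x0" "t \<in> J" "0 \<le> t" "x0 \<in> K i" for J x t x0
    using forward_invariant_of_inward_field[OF H(1) K(3) compact_imp_closed[OF K(1)] assms(6,7)] that
    by blast
  show "\<exists>\<delta>>0. \<forall>x0\<in>G. dist x0 0 < \<delta> \<longrightarrow>
        (\<exists>x. solution_on G f {0..} x \<and> x 0 = x0) \<and>
        (\<forall>J x. solution_on G f J x \<and> 0 \<in> J \<and> x 0 = x0 \<longrightarrow> (\<forall>t\<in>J. 0 \<le> t \<longrightarrow> dist (x t) 0 < \<epsilon>))"
  proof (intro exI[of _ \<delta>] conjI ballI impI allI)
    fix x0 :: "real ^ 'n" assume "dist x0 0 < \<delta>"
    then have x0: "x0 \<in> K i"
      using \<delta>(2) by auto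
    show "\<exists>x. solution_on G f {0..} x \<and> x 0 = x0"
      by (rule global_solution_in_compact[OF assms(2,3) K(1) i(2) x0]) (rule invariant[OF _ _ _ _ _ x0])
    show "dist (x t) 0 < \<epsilon>"
      if "solution_on G f J x \<and> 0 \<in> J \<and> x 0 = x0" "t \<in> J" "0 \<le> t" for J x t
      using invariant[of J x x0 t] that x0 i(1) by auto
  qed (fact \<delta>(1))
qed

end
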